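(* For any set $\Gamma\cup\{\phi\}$ of $\mathbf{CPL}(\dot\vee)$-formulas, if $\Gamma\vdash\phi$ in the natural deduction system of $\mathbf{CPL}(\dot\vee)$, then $\Gamma\models\phi$.
   Context: Fix a set $\mathsf{Prop}$ of propositional variables. Classical formulas: $\alpha::=p\mid\bot\mid\top\mid\neg\alpha\mid(\alpha\wedge\alpha)\mid(\alpha\vee\alpha)$ with $p\in\mathsf{Prop}$. Formulas of $\mathbf{CPL}(\dot\vee)$: $\phi::=p\mid\bot\mid\top\mid\neg\alpha\mid(\phi\wedge\phi)\mid(\phi\vee\phi)\mid(\phi\mathbin{\dot\vee}\phi)$ with $\alpha$ classical ($\dot\vee$ is the relevant disjunction). For $\mathsf N\subseteq\mathsf{Prop}$, a valuation on $\mathsf N$ is a function $v:\mathsf N\cup\{\bot,\top\}\to\{0,1\}$ with $v(\bot)=0$, $v(\top)=1$; an $\mathsf N$-team is a set $X$ of valuations on $\mathsf N$, with $\mathsf{dom}(X)=\mathsf N$ (the empty set is a team of any domain). Team semantics, for $X$ whose domain contains the variables $\mathsf{Prop}(\phi)$ of $\phi$: $X\models p$ iff $v(p)=1$ for all $v\in X$; $X\models\bot$ iff $X=\emptyset$; $X\models\top$ always; $X\models\neg\alpha$ iff $\{v\}\not\models\alpha$ for all $v\in X$; $X\models\phi\wedge\psi$ iff $X\models\phi$ and $X\models\psi$; $X\models\phi\vee\psi$ iff there are $Y,Z\subseteq X$ with $X=Y\cup Z$, $Y\models\phi$, $Z\models\psi$; $X\models\phi\mathbin{\dot\vee}\psi$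 iff $X=\emptyset$ or there are nonempty $Y,Z\subseteq X$ with $X=Y\cup Z$, $Y\models\phi$, $Z\models\psi$. $\Gamma\models\phi$ means: every team $X$ whose domain contains all variables of $\Gamma\cup\{\phi\}$ and which satisfies every $\gamma\in\Gamma$ satisfies $\phi$. Natural deduction system of $\mathbf{CPL}(\dot\vee)$: $\Gamma\vdash\phi$ means there is a derivation of $\phi$ all of whose undischarged assumptions lie in $\Gamma$. In sequent notation, $\vdash$ is the least relation such that $\Gamma\vdash\phi$ for $\phi\in\Gamma$, $\Gamma\vdash\phi$ implies $\Gamma\cup\Gamma'\vdash\phi$, and which is closed under the following rules, where $\alpha$ ranges over classical formulas, $\phi,\psi,\chi$ over all formulas, $\Gamma$ over sets of formulas, and $\Delta$ over sets of classical formulas only: - $\top$I: $\Gamma\vdash\top$. - $\neg$I: from $\Delta,\alpha\vdash\bot$ infer $\Delta\vdash\neg\alpha$. - RAA: from $\Delta,\neg\alpha\vdash\bot$ infer $\Delta\vdash\alpha$. - $\neg$E: from $\Gamma\vdash\alpha$ and $\Gamma\vdash\neg\alpha$ infer $\Gamma\vdash\phi$. - $\wedge$I: from $\Gamma\vdash\phi$ and $\Gamma\vdash\psi$ infer $\Gamma\vdash\phi\wedge\psi$. $\wedge$E: from $\Gamma\vdash\phi\wedge\psi$ infer $\Gamma\vdash\phi$, and infer $\Gamma\vdash\psi$. - $\vee$I: from $\Gamma\vdash\phi$ infer $\Gamma\vdash\phi\vee\psi$, and infer $\Gamma\vdash\psi\vee\phi$. - $\vee$E: from $\Gamma\vdash\phi\vee\psi$,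 $\Delta,\phi\vdash\chi$ and $\Delta,\psi\vdash\chi$ infer $\Gamma\cup\Delta\vdash\chi$. - $\dot\vee$I: from $\Gamma\vdash\phi$ and $\Gamma\vdash\psi$ infer $\Gamma\vdash\phi\mathbin{\dot\vee}\psi$. - $\dot\vee$Mon: from $\Gamma\vdash\phi\mathbin{\dot\vee}\psi$ and $\Delta,\phi\vdash\chi$ infer $\Gamma\cup\Delta\vdash\chi\mathbin{\dot\vee}\psi$. - $\dot\vee$Com: from $\Gamma\vdash\phi\mathbin{\dot\vee}\psi$ infer $\Gamma\vdash\psi\mathbin{\dot\vee}\phi$. $\dot\vee$Ass: from $\Gamma\vdash\phi\mathbin{\dot\vee}(\psi\mathbin{\dot\vee}\chi)$ infer $\Gamma\vdash(\phi\mathbin{\dot\vee}\psi)\mathbin{\dot\vee}\chi$. - $\vee\mathrm{E}_{\dot\vee}$: from $\Gamma\vdash\phi\vee\psi$, $\Gamma,\phi\vdash\chi$, $\Gamma,\psi\vdash\chi$ and $\Gamma,\phi\mathbin{\dot\vee}\psi\vdash\chi$ infer $\Gamma\vdash\chi$. - $\dot\vee\vee$Tr: from $\Gamma\vdash\phi\mathbin{\dot\vee}\psi$ infer $\Gamma\vdash\phi\vee\psi$. - $\dot\vee\bot$E: from $\Gamma\vdash\phi\mathbin{\dot\vee}\bot$ infer $\Gamma\vdash\psi$. - Dstr$\dot\vee\vee$: from $\Gamma\vdash\phi\mathbin{\dot\vee}(\psi\vee\chi)$ infer $\Gamma\vdash(\phi\mathbin{\dot\vee}\psi)\vee(\phi\mathbin{\dot\vee}\chi)$.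 *)

theory Defs
  imports Main
begin

text \<open>
  The set of propositional variables is the type parameter. The datatype allows negation of
  arbitrary formulas; the grammar, in which only classical formulas are negated, is imposed by
  the predicate \<open>formula\<close>.
\<close>

datatype 'p fm =
    Var 'p
  | Bot  ("\<^bold>\<bottom>")
  | Top  ("\<^bold>\<top>")
  | Neg "'p fm"  ("\<^bold>\<not> _" [85] 85)
  | Con "'p fm" "'p fm"  (infixr "\<^bold>\<and>" 80)
  | Dis "'p fm" "'p fm"  (infixr "\<^bold>\<or>" 75)
  | RDis "'p fm" "'p fm"  (infixr "\<or>\<^sup>\<bullet>" 75)

primrec classical :: "'p fm \<Rightarrow> bool" where
  "classical (Var p) = True"
| "classical \<^bold>\<bottom> = True"
| "classical \<^bold>\<top> = True"
| "classical (\<^bold>\<not> \<alpha>) = classical \<alpha>"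
| "classical (\<phi> \<^bold>\<and> \<psi>) = (classical \<phi> \<and> classical \<psi>)"
| "classical (\<phi> \<^bold>\<or> \<psi>) = (classical \<phi> \<and> classical \<psi>)"
| "classical (\<phi> \<or>\<^sup>\<bullet> \<psi>) = False"

primrec formula :: "'p fm \<Rightarrow> bool" where
  "formula (Var p) = True"
| "formula \<^bold>\<bottom> = True"
| "formula \<^bold>\<top> = True"
| "formula (\<^bold>\<not> \<alpha>) = classical \<alpha>"
| "formula (\<phi> \<^bold>\<and> \<psi>) = (formula \<phi> \<and> formula \<psi>)"
| "formula (\<phi> \<^bold>\<or> \<psi>) = (formula \<phi> \<and> formula \<psi>)"
| "formula (\<phi> \<or>\<^sup>\<bullet> \<psi>) = (formula \<phi> \<and> formula \<psi>)"

primrec vars :: "'p fm \<Rightarrow> 'p set" where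
  "vars (Var p) = {p}"
| "vars \<^bold>\<bottom> = {}"
| "vars \<^bold>\<top> = {}"
| "vars (\<^bold>\<not> \<alpha>) = vars \<alpha>"
| "vars (\<phi> \<^bold>\<and> \<psi>) = vars \<phi> \<union> vars \<psi>"
| "vars (\<phi> \<^bold>\<or> \<psi>) = vars \<phi> \<union> vars \<psi>"
| "vars (\<phi> \<or>\<^sup>\<bullet> \<psi>) = vars \<phi> \<union> vars \<psi>"

text \<open>
  A valuation on \<open>N\<close> is a partial map with domain exactly \<open>N\<close>. Its values at the constants
  are forced and never consulted by the team semantics, so they are not represented.
\<close>

type_synonym 'p valuation = "'p \<rightharpoonup> bool"
type_synonym 'p team = "'p valuation set"

definition team_on :: "'p set \<Rightarrow> 'p team \<Rightarrow> bool" where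
  "team_on N X \<longleftrightarrow> (\<forall>v\<in>X. dom v = N)"

text \<open>Meaningful only for teams whose domain contains \<open>vars \<phi>\<close>; \<open>entails\<close> ensures this.\<close>

primrec sat :: "'p team \<Rightarrow> 'p fm \<Rightarrow> bool"  (infix "\<TTurnstile>" 50) where
  "X \<TTurnstile> Var p \<longleftrightarrow> (\<forall>v\<in>X. v p = Some True)"
| "X \<TTurnstile> \<^bold>\<bottom> \<longleftrightarrow> X = {}"
| "X \<TTurnstile> \<^bold>\<top> \<longleftrightarrow> True"
| "X \<TTurnstile> \<^bold>\<not> \<alpha> \<longleftrightarrow> (\<forall>v\<in>X. \<not> {v} \<TTurnstile> \<alpha>)"
| "X \<TTurnstile> \<phi> \<^bold>\<and> \<psi> \<longleftrightarrow> X \<TTurnstile> \<phi> \<and> X \<TTurnstile> \<psi>"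
| "X \<TTurnstile> \<phi> \<^bold>\<or> \<psi> \<longleftrightarrow> (\<exists>Y Z. Y \<subseteq> X \<and> Z \<subseteq> X \<and> X = Y \<union> Z \<and> Y \<TTurnstile> \<phi> \<and> Z \<TTurnstile> \<psi>)"
| "X \<TTurnstile> \<phi> \<or>\<^sup>\<bullet> \<psi> \<longleftrightarrow> X = {} \<or>
     (\<exists>Y Z. Y \<noteq> {} \<and> Z \<noteq> {} \<and> Y \<subseteq> X \<and> Z \<subseteq> X \<and> X = Y \<union> Z \<and> Y \<TTurnstile> \<phi> \<and> Z \<TTurnstile> \<psi>)"

definition entails :: "'p fm set \<Rightarrow> 'p fm \<Rightarrow> bool"  (infix "\<Turnstile>" 50) where
  "\<Gamma> \<Turnstile> \<phi> \<longleftrightarrow>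
     (\<forall>N X. team_on N X \<longrightarrow> (\<Union>\<gamma>\<in>\<Gamma> \<union> {\<phi>}. vars \<gamma>) \<subseteq> N \<longrightarrow> (\<forall>\<gamma>\<in>\<Gamma>. X \<TTurnstile> \<gamma>) \<longrightarrow> X \<TTurnstile> \<phi>)"

text \<open>
  The \<open>classical\<close> premises restrict \<open>\<alpha>\<close> and \<open>\<Delta>\<close>; the \<open>formula\<close> premises
  occur only where a formula not already covered by the premise sequents is introduced. By
  induction, every derivable sequent consists of formulas of the logic.
\<close>

inductive derives :: "'p fm set \<Rightarrow> 'p fm \<Rightarrow> bool"  (infix "\<turnstile>" 50) where
  Assm: "\<forall>\<gamma>\<in>\<Gamma>. formula \<gamma> \<Longrightarrow> \<phi> \<in> \<Gamma> \<Longrightarrow> \<Gamma> \<turnstile> \<phi>"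
| Weak: "\<Gamma> \<turnstile> \<phi> \<Longrightarrow> \<forall>\<gamma>\<in>\<Gamma>'. formula \<gamma> \<Longrightarrow> \<Gamma> \<union> \<Gamma>' \<turnstile> \<phi>"
| TopI: "\<forall>\<gamma>\<in>\<Gamma>. formula \<gamma> \<Longrightarrow> \<Gamma> \<turnstile> \<^bold>\<top>"
| NegI: "\<forall>\<delta>\<in>\<Delta>. classical \<delta> \<Longrightarrow> classical \<alpha> \<Longrightarrow> \<Delta> \<union> {\<alpha>} \<turnstile> \<^bold>\<bottom> \<Longrightarrow> \<Delta> \<turnstile> \<^bold>\<not> \<alpha>"
| RAA: "\<forall>\<delta>\<in>\<Delta>. classical \<delta> \<Longrightarrow> classical \<alpha> \<Longrightarrow> \<Delta> \<union> {\<^bold>\<not> \<alpha>} \<turnstile> \<^bold>\<bottom> \<Longrightarrow> \<Delta> \<turnstile> \<alpha>"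
| NegE: "classical \<alpha> \<Longrightarrow> formula \<phi> \<Longrightarrow> \<Gamma> \<turnstile> \<alpha> \<Longrightarrow> \<Gamma> \<turnstile> \<^bold>\<not> \<alpha> \<Longrightarrow> \<Gamma> \<turnstile> \<phi>"
| ConI: "\<Gamma> \<turnstile> \<phi> \<Longrightarrow> \<Gamma> \<turnstile> \<psi> \<Longrightarrow> \<Gamma> \<turnstile> \<phi> \<^bold>\<and> \<psi>"
| ConE1: "\<Gamma> \<turnstile> \<phi> \<^bold>\<and> \<psi> \<Longrightarrow> \<Gamma> \<turnstile> \<phi>"
| ConE2: "\<Gamma> \<turnstile> \<phi> \<^bold>\<and> \<psi> \<Longrightarrow> \<Gamma> \<turnstile> \<psi>"
| DisI1: "formula \<psi> \<Longrightarrow> \<Gamma> \<turnstile> \<phi> \<Longrightarrow> \<Gamma> \<turnstile> \<phi> \<^bold>\<or> \<psi>"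
| DisI2: "formula \<psi> \<Longrightarrow> \<Gamma> \<turnstile> \<phi> \<Longrightarrow> \<Gamma> \<turnstile> \<psi> \<^bold>\<or> \<phi>"
| DisE: "\<forall>\<delta>\<in>\<Delta>. classical \<delta> \<Longrightarrow> \<Gamma> \<turnstile> \<phi> \<^bold>\<or> \<psi> \<Longrightarrow> \<Delta> \<union> {\<phi>} \<turnstile> \<chi> \<Longrightarrow> \<Delta> \<union> {\<psi>} \<turnstile> \<chi> \<Longrightarrow> \<Gamma> \<union> \<Delta> \<turnstile> \<chi>"
| RDisI: "\<Gamma> \<turnstile> \<phi> \<Longrightarrow> \<Gamma> \<turnstile> \<psi> \<Longrightarrow> \<Gamma> \<turnstile> \<phi> \<or>\<^sup>\<bullet> \<psi>"
| RDisMon: "\<forall>\<delta>\<in>\<Delta>. classical \<delta> \<Longrightarrow> \<Gamma> \<turnstile> \<phi> \<or>\<^sup>\<bullet> \<psi> \<Longrightarrow> \<Delta> \<union> {\<phi>} \<turnstile> \<chi> \<Longrightarrow> \<Gamma> \<union> \<Delta> \<turnstile> \<chi> \<or>\<^sup>\<bullet> \<psi>"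
| RDisCom: "\<Gamma> \<turnstile> \<phi> \<or>\<^sup>\<bullet> \<psi> \<Longrightarrow> \<Gamma> \<turnstile> \<psi> \<or>\<^sup>\<bullet> \<phi>"
| RDisAss: "\<Gamma> \<turnstile> \<phi> \<or>\<^sup>\<bullet> (\<psi> \<or>\<^sup>\<bullet> \<chi>) \<Longrightarrow> \<Gamma> \<turnstile> (\<phi> \<or>\<^sup>\<bullet> \<psi>) \<or>\<^sup>\<bullet> \<chi>"
| DisERDis: "\<Gamma> \<turnstile> \<phi> \<^bold>\<or> \<psi> \<Longrightarrow> \<Gamma> \<union> {\<phi>} \<turnstile> \<chi> \<Longrightarrow> \<Gamma> \<union> {\<psi>} \<turnstile> \<chi> \<Longrightarrow> \<Gamma> \<union> {\<phi> \<or>\<^sup>\<bullet> \<psi>} \<turnstile> \<chi> \<Longrightarrow> \<Gamma> \<turnstile> \<chi>"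
| RDisDisTr: "\<Gamma> \<turnstile> \<phi> \<or>\<^sup>\<bullet> \<psi> \<Longrightarrow> \<Gamma> \<turnstile> \<phi> \<^bold>\<or> \<psi>"
| RDisBotE: "formula \<psi> \<Longrightarrow> \<Gamma> \<turnstile> \<phi> \<or>\<^sup>\<bullet> \<^bold>\<bottom> \<Longrightarrow> \<Gamma> \<turnstile> \<psi>"
| DstrRDisDis: "\<Gamma> \<turnstile> \<phi> \<or>\<^sup>\<bullet> (\<psi> \<^bold>\<or> \<chi>) \<Longrightarrow> \<Gamma> \<turnstile> (\<phi> \<or>\<^sup>\<bullet> \<psi>) \<^bold>\<or> (\<phi> \<or>\<^sup>\<bullet> \<chi>)"

end

theory Submission
  imports Defs
begin

text \<open>
  The proof is an induction on derivations, resting on three closure properties of team semantics: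
  the empty team satisfies every formula, satisfaction is closed under unions of teams, and
  classical formulas are flat, that is, a team satisfies them iff each of its valuations does so on
  its own. Union closure makes \<open>\<or>\<close>-elimination sound although its conclusion may contain the
  relevant disjunction: the two halves of a split team satisfy the conclusion, hence so does their
  union. Flatness explains why the side assumptions of the rules that change the team must be
  classical: such assumptions survive the passage to a subteam, which formulas with \<open>\<or>\<^sup>\<bullet>\<close> need
  not do. The empty team property settles every case where satisfaction forces the team to be empty.

  A derivation may pass through formulas with variables outside the domain of the given team, so
  the induction cannot be carried out for \<open>\<Turnstile>\<close> directly. The usual remedy is locality, extending the
  team to the missing variables. Here an undefined variable simply counts as false: negation
  complements satisfaction at a single valuation whatever its domain, so the induction goes
  through for arbitrary sets of partial valuations, and the domain condition is imposed only
  at the end.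
\<close>

lemma sat_empty: "{} \<TTurnstile> \<phi>"
  by (induction \<phi>) auto

lemma sat_DisI:
  assumes "Y \<TTurnstile> \<phi>" and "Z \<TTurnstile> \<psi>" and "X = Y \<union> Z"
  shows "X \<TTurnstile> \<phi> \<^bold>\<or> \<psi>"
  unfolding sat.simps using assms by (intro exI[of _ Y] exI[of _ Z]) simp

lemma sat_RDisI:
  assumes "Y \<TTurnstile> \<phi>" and "Z \<TTurnstile> \<psi>" and "Y \<noteq> {}" and "Z \<noteq> {}" and "X = Y \<union> Z"
  shows "X \<TTurnstile> \<phi> \<or>\<^sup>\<bullet> \<psi>"
  unfolding sat.simps using assms by (intro disjI2 exI[of _ Y] exI[of _ Z]) simp

lemma sat_RDisE:
  assumes "X \<TTurnstile> \<phi> \<or>\<^sup>\<bullet> \<psi>" and "X \<noteq> {}"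
  obtains Y Z where "X = Y \<union> Z" "Y \<noteq> {}" "Y \<TTurnstile> \<phi>" "Z \<noteq> {}" "Z \<TTurnstile> \<psi>"
  using assms by auto

text \<open>
  The splits of two teams are united componentwise. For \<open>\<or>\<^sup>\<bullet>\<close> the components stay nonempty,
  and if one team is empty, the split of the other one serves.
\<close>

lemma sat_union:
  assumes "X \<TTurnstile> \<phi>" and "Y \<TTurnstile> \<phi>"
  shows "X \<union> Y \<TTurnstile> \<phi>"
  using assms
proof (induction \<phi> arbitrary: X Y)
  case (Dis \<phi> \<psi>)
  then obtain X1 X2 Y1 Y2 where "X = X1 \<union> X2" "X1 \<TTurnstile> \<phi>" "X2 \<TTurnstile> \<psi>"
    "Y = Y1 \<union> Y2" "Y1 \<TTurnstile> \<phi>" "Y2 \<TTurnstile> \<psi>"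
    by auto
  then have "X \<union> Y = (X1 \<union> Y1) \<union> (X2 \<union> Y2)" "X1 \<union> Y1 \<TTurnstile> \<phi>" "X2 \<union> Y2 \<TTurnstile> \<psi>"
    using Dis.IH by auto
  then show ?case
    by (intro sat_DisI)
next
  case (RDis \<phi> \<psi>)
  show ?case
  proof (cases "X = {} \<or> Y = {}")
    case True
    then show ?thesis
      using RDis.prems by (elim disjE) (simp_all del: sat.simps)
  next
    case False
    then obtain X1 X2 where X: "X = X1 \<union> X2" "X1 \<noteq> {}" "X1 \<TTurnstile> \<phi>" "X2 \<noteq> {}" "X2 \<TTurnstile> \<psi>"
      using sat_RDisE[OF RDis.prems(1)] by metis
    from False obtain Y1 Y2 where Y: "Y = Y1 \<union> Y2" "Y1 \<TTurnstile> \<phi>" "Y2 \<TTurnstile> \<psi>"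
      using sat_RDisE[OF RDis.prems(2)] by metis
    from X Y have "X \<union> Y = (X1 \<union> Y1) \<union> (X2 \<union> Y2)" "X1 \<union> Y1 \<TTurnstile> \<phi>" "X2 \<union> Y2 \<TTurnstile> \<psi>"
      "X1 \<union> Y1 \<noteq> {}" "X2 \<union> Y2 \<noteq> {}"
      using RDis.IH by auto
    then show ?thesis
      by (intro sat_RDisI)
  qed
qed auto

lemma sat_Dis_singleton: "{v} \<TTurnstile> \<phi> \<^bold>\<or> \<psi> \<longleftrightarrow> {v} \<TTurnstile> \<phi> \<or> {v} \<TTurnstile> \<psi>"
proof
  assume "{v} \<TTurnstile> \<phi> \<^bold>\<or> \<psi>"
  then obtain Y Z where "Y \<subseteq> {v}" "Z \<subseteq> {v}" "{v} = Y \<union> Z" "Y \<TTurnstile> \<phi>" "Z \<TTurnstile> \<psi>"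
    by auto
  moreover from this have "Y = {v} \<or> Z = {v}"
    by blast
  ultimately show "{v} \<TTurnstile> \<phi> \<or> {v} \<TTurnstile> \<psi>"
    by auto
next
  assume "{v} \<TTurnstile> \<phi> \<or> {v} \<TTurnstile> \<psi>"
  then show "{v} \<TTurnstile> \<phi> \<^bold>\<or> \<psi>"
    using sat_empty[of \<phi>] sat_empty[of \<psi>] by auto
qed

text \<open>
  In the disjunction case the canonical split of a team collects, for each disjunct, all
  valuations that satisfy it.
\<close>

lemma sat_classical_flat:
  assumes "classical \<alpha>"
  shows "X \<TTurnstile> \<alpha> \<longleftrightarrow> (\<forall>v\<in>X. {v} \<TTurnstile> \<alpha>)"
  using assms
proof (induction \<alpha> arbitrary: X)
  case (Neg \<alpha>)
  show ?case
    by simp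
next
  case (Con \<alpha> \<beta>)
  then have "classical \<alpha>" "classical \<beta>"
    by simp_all
  then show ?case
    using Con.IH(1)[of X] Con.IH(2)[of X] by auto
next
  case (Dis \<alpha> \<beta>)
  then have "classical \<alpha>" "classical \<beta>"
    by simp_all
  note flat = Dis.IH(1)[OF this(1)] Dis.IH(2)[OF this(2)]
  show ?case
  proof
    assume "X \<TTurnstile> \<alpha> \<^bold>\<or> \<beta>"
    then obtain Y Z where "X = Y \<union> Z" "Y \<TTurnstile> \<alpha>" "Z \<TTurnstile> \<beta>"
      by auto
    then show "\<forall>v\<in>X. {v} \<TTurnstile> \<alpha> \<^bold>\<or> \<beta>"
      unfolding sat_Dis_singleton using flat(1)[of Y] flat(2)[of Z] by blast
  next
    assume *: "\<forall>v\<in>X. {v} \<TTurnstile> \<alpha> \<^bold>\<or> \<beta>"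
    let ?Y = "{v \<in> X. {v} \<TTurnstile> \<alpha>}" and ?Z = "{v \<in> X. {v} \<TTurnstile> \<beta>}"
    have "X = ?Y \<union> ?Z"
      using * unfolding sat_Dis_singleton by blast
    moreover have "?Y \<TTurnstile> \<alpha>" "?Z \<TTurnstile> \<beta>"
      using flat(1)[of ?Y] flat(2)[of ?Z] by blast+
    ultimately show "X \<TTurnstile> \<alpha> \<^bold>\<or> \<beta>"
      by (intro sat_DisI)
  qed
qed auto

lemma sat_classical_subteam:
  assumes "\<forall>\<delta>\<in>\<Delta>. classical \<delta>" and "\<forall>\<delta>\<in>\<Delta>. X \<TTurnstile> \<delta>" and "Y \<subseteq> X"
  shows "\<forall>\<delta>\<in>\<Delta>. Y \<TTurnstile> \<delta>"
proof
  fix \<delta>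
  assume "\<delta> \<in> \<Delta>"
  then have "classical \<delta>" "X \<TTurnstile> \<delta>"
    using assms by auto
  then show "Y \<TTurnstile> \<delta>"
    using sat_classical_flat[of \<delta> X] sat_classical_flat[of \<delta> Y] assms(3) by blast
qed

lemma sat_RDis_assoc:
  assumes "X \<TTurnstile> \<phi> \<or>\<^sup>\<bullet> (\<psi> \<or>\<^sup>\<bullet> \<chi>)"
  shows "X \<TTurnstile> (\<phi> \<or>\<^sup>\<bullet> \<psi>) \<or>\<^sup>\<bullet> \<chi>"
proof (cases "X = {}")
  case True
  then show ?thesis
    by simp
next
  case False
  then obtain Y Z where X: "X = Y \<union> Z" "Y \<noteq> {}" "Y \<TTurnstile> \<phi>" "Z \<noteq> {}" "Z \<TTurnstile> \<psi> \<or>\<^sup>\<bullet> \<chi>"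
    using sat_RDisE[OF assms] by metis
  obtain Z1 Z2 where Z: "Z = Z1 \<union> Z2" "Z1 \<noteq> {}" "Z1 \<TTurnstile> \<psi>" "Z2 \<noteq> {}" "Z2 \<TTurnstile> \<chi>"
    using sat_RDisE[OF X(5,4)] by metis
  have "Y \<union> Z1 \<TTurnstile> \<phi> \<or>\<^sup>\<bullet> \<psi>"
    using sat_RDisI X Z by metis
  moreover have "X = (Y \<union> Z1) \<union> Z2" "Y \<union> Z1 \<noteq> {}"
    using X Z by auto
  ultimately show ?thesis
    using sat_RDisI Z by metis
qed

text \<open>
  A split with an empty part leaves the whole team to the other disjunct, and any other split
  witnesses the relevant disjunction.
\<close>

lemma sat_Dis_cases:
  assumes "X \<TTurnstile> \<phi> \<^bold>\<or> \<psi>"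
  shows "X \<TTurnstile> \<phi> \<or> X \<TTurnstile> \<psi> \<or> X \<TTurnstile> \<phi> \<or>\<^sup>\<bullet> \<psi>"
proof -
  obtain Y Z where X: "X = Y \<union> Z" "Y \<TTurnstile> \<phi>" "Z \<TTurnstile> \<psi>"
    using assms by auto
  consider "Y = {}" | "Z = {}" | "Y \<noteq> {}" "Z \<noteq> {}"
    by blast
  then show ?thesis
  proof cases
    case 3
    then have "X \<TTurnstile> \<phi> \<or>\<^sup>\<bullet> \<psi>"
      using sat_RDisI X by metis
    then show ?thesis
      by blast
  qed (use X in auto)
qed

lemma sat_RDis_imp_Dis:
  assumes "X \<TTurnstile> \<phi> \<or>\<^sup>\<bullet> \<psi>"
  shows "X \<TTurnstile> \<phi> \<^bold>\<or> \<psi>"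
proof (cases "X = {}")
  case True
  then show ?thesis
    using sat_empty by blast
next
  case False
  then show ?thesis
    using sat_RDisE[OF assms] sat_DisI by metis
qed

text \<open>
  If the part of the team that satisfies \<open>\<psi> \<or> \<chi>\<close> splits trivially, one disjunct of the conclusion
  is satisfied by the whole team and the other one by the empty team. Otherwise the part that
  satisfies \<open>\<phi>\<close> is used in both disjuncts.
\<close>

lemma sat_RDis_distrib_Dis:
  assumes "X \<TTurnstile> \<phi> \<or>\<^sup>\<bullet> (\<psi> \<^bold>\<or> \<chi>)"
  shows "X \<TTurnstile> (\<phi> \<or>\<^sup>\<bullet> \<psi>) \<^bold>\<or> (\<phi> \<or>\<^sup>\<bullet> \<chi>)"
proof (cases "X = {}")
  case True
  then show ?thesis
    using sat_empty by blast
next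
  case False
  then obtain Y Z where X: "X = Y \<union> Z" "Y \<noteq> {}" "Y \<TTurnstile> \<phi>" "Z \<noteq> {}" "Z \<TTurnstile> \<psi> \<^bold>\<or> \<chi>"
    using sat_RDisE[OF assms] by metis
  have whole: "X \<TTurnstile> \<phi> \<or>\<^sup>\<bullet> \<theta>" if "Z \<TTurnstile> \<theta>" for \<theta>
    using sat_RDisI X that by metis
  consider "Z \<TTurnstile> \<psi>" | "Z \<TTurnstile> \<chi>" | "Z \<TTurnstile> \<psi> \<or>\<^sup>\<bullet> \<chi>"
    using sat_Dis_cases[OF X(5)] by blast
  then show ?thesis
  proof cases
    case 1
    show ?thesis
      by (rule sat_DisI[OF whole[OF 1] sat_empty]) simp
  next
    case 2
    show ?thesis
      by (rule sat_DisI[OF sat_empty whole[OF 2]]) simp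
  next
    case 3
    then obtain Z1 Z2 where Z: "Z = Z1 \<union> Z2" "Z1 \<noteq> {}" "Z1 \<TTurnstile> \<psi>" "Z2 \<noteq> {}" "Z2 \<TTurnstile> \<chi>"
      using sat_RDisE[OF _ X(4)] by metis
    have "Y \<union> Z1 \<TTurnstile> \<phi> \<or>\<^sup>\<bullet> \<psi>" "Y \<union> Z2 \<TTurnstile> \<phi> \<or>\<^sup>\<bullet> \<chi>"
      using sat_RDisI X Z by metis+
    moreover have "X = (Y \<union> Z1) \<union> (Y \<union> Z2)"
      using X Z by auto
    ultimately show ?thesis
      by (intro sat_DisI)
  qed
qed

text \<open>
  The premises of a rule may mention variables that its conclusion lacks, so the induction
  hypotheses have to apply to teams whose valuations are undefined there. Hence \<open>X\<close> is an arbitrary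
  set of partial valuations.
\<close>

lemma derives_sound_partial:
  assumes "\<Gamma> \<turnstile> \<phi>" and "\<forall>\<gamma>\<in>\<Gamma>. X \<TTurnstile> \<gamma>"
  shows "X \<TTurnstile> \<phi>"
  using assms
proof (induction arbitrary: X rule: derives.induct)
  case (NegI \<Delta> \<alpha>)
  have "\<not> {v} \<TTurnstile> \<alpha>" if "v \<in> X" for v
  proof
    assume "{v} \<TTurnstile> \<alpha>"
    moreover have "\<forall>\<delta>\<in>\<Delta>. {v} \<TTurnstile> \<delta>"
      using sat_classical_subteam[OF NegI.hyps(1) NegI.prems] that by simp
    ultimately have "{v} \<TTurnstile> \<^bold>\<bottom>"
      using NegI.IH by blast
    then show False
      by simp
  qed
  then show ?case
    by simp
next
  case (RAA \<Delta> \<alpha>)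
  have "{v} \<TTurnstile> \<alpha>" if "v \<in> X" for v
  proof (rule ccontr)
    assume "\<not> {v} \<TTurnstile> \<alpha>"
    then have "{v} \<TTurnstile> \<^bold>\<not> \<alpha>"
      by simp
    moreover have "\<forall>\<delta>\<in>\<Delta>. {v} \<TTurnstile> \<delta>"
      using sat_classical_subteam[OF RAA.hyps(1) RAA.prems] that by simp
    ultimately have "{v} \<TTurnstile> \<^bold>\<bottom>"
      using RAA.IH by blast
    then show False
      by simp
  qed
  then show ?case
    using sat_classical_flat[OF RAA.hyps(2), of X] by blast
next
  case (NegE \<alpha> \<phi> \<Gamma>)
  then have "X \<TTurnstile> \<alpha>" "X \<TTurnstile> \<^bold>\<not> \<alpha>"
    by blast+
  then have "X = {}"
    using sat_classical_flat[OF NegE.hyps(1), of X] by auto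
  then show ?case
    using sat_empty by blast
next
  case (DisI1 \<psi> \<Gamma> \<phi>)
  then show ?case
    by (intro sat_DisI[OF _ sat_empty]) auto
next
  case (DisI2 \<psi> \<Gamma> \<phi>)
  then show ?case
    by (intro sat_DisI[OF sat_empty]) auto
next
  case (DisE \<Delta> \<Gamma> \<phi> \<psi> \<chi>)
  then have "X \<TTurnstile> \<phi> \<^bold>\<or> \<psi>"
    by blast
  then obtain Y Z where X: "X = Y \<union> Z" "Y \<TTurnstile> \<phi>" "Z \<TTurnstile> \<psi>"
    by auto
  have \<Delta>: "\<forall>\<delta>\<in>\<Delta>. W \<TTurnstile> \<delta>" if "W \<subseteq> X" for W
    by (rule sat_classical_subteam[OF DisE.hyps(1) _ that]) (use DisE.prems in simp)
  have "Y \<TTurnstile> \<chi>" "Z \<TTurnstile> \<chi>"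
    using X \<Delta>[of Y] \<Delta>[of Z] DisE.IH(2)[of Y] DisE.IH(3)[of Z] by simp_all
  then show ?case
    unfolding X(1) by (rule sat_union)
next
  case (RDisI \<Gamma> \<phi> \<psi>)
  then have "X \<TTurnstile> \<phi>" "X \<TTurnstile> \<psi>"
    by blast+
  then show ?case
    using sat_RDisI[of X \<phi> X \<psi> X] by (cases "X = {}") simp_all
next
  case (RDisMon \<Delta> \<Gamma> \<phi> \<psi> \<chi>)
  show ?case
  proof (cases "X = {}")
    case True
    then show ?thesis
      by simp
  next
    case False
    have "X \<TTurnstile> \<phi> \<or>\<^sup>\<bullet> \<psi>"
      using RDisMon by blast
    with False obtain Y Z where
      X: "X = Y \<union> Z" "Y \<noteq> {}" "Y \<TTurnstile> \<phi>" "Z \<noteq> {}" "Z \<TTurnstile> \<psi>"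
      using sat_RDisE by metis
    have "\<forall>\<delta>\<in>\<Delta>. Y \<TTurnstile> \<delta>"
      using sat_classical_subteam[OF RDisMon.hyps(1), of X Y] RDisMon.prems X(1) by simp
    then have "Y \<TTurnstile> \<chi>"
      using X(3) RDisMon.IH(2)[of Y] by simp
    then show ?thesis
      using sat_RDisI X by metis
  qed
next
  case (RDisCom \<Gamma> \<phi> \<psi>)
  then have "X \<TTurnstile> \<phi> \<or>\<^sup>\<bullet> \<psi>"
    by blast
  then show ?case
    using sat_RDisE sat_RDisI sat_empty Un_commute by metis
next
  case (RDisAss \<Gamma> \<phi> \<psi> \<chi>)
  then show ?case
    by (intro sat_RDis_assoc) blast
next
  case (DisERDis \<Gamma> \<phi> \<psi> \<chi>)
  then show ?case
    using sat_Dis_cases[of X \<phi> \<psi>] by blast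
next
  case (RDisDisTr \<Gamma> \<phi> \<psi>)
  then show ?case
    by (intro sat_RDis_imp_Dis) blast
next
  case (RDisBotE \<psi> \<Gamma> \<phi>)
  then have "X \<TTurnstile> \<phi> \<or>\<^sup>\<bullet> \<^bold>\<bottom>"
    by blast
  then have "X = {}"
    unfolding sat.simps by blast
  then show ?case
    using sat_empty by blast
next
  case (DstrRDisDis \<Gamma> \<phi> \<psi> \<chi>)
  then show ?case
    by (intro sat_RDis_distrib_Dis) blast
next
  case (ConI \<Gamma> \<phi> \<psi>)
  then show ?case
    by simp
next
  case (ConE1 \<Gamma> \<phi> \<psi>)
  then have "X \<TTurnstile> \<phi> \<^bold>\<and> \<psi>"
    by blast
  then show ?case
    by simp
next
  case (ConE2 \<Gamma> \<phi> \<psi>)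
  then have "X \<TTurnstile> \<phi> \<^bold>\<and> \<psi>"
    by blast
  then show ?case
    by simp
qed (blast | simp)+

theorem theorem4p3:
  fixes \<Gamma> :: "'p fm set" and \<phi> :: "'p fm"
  assumes "\<forall>\<gamma>\<in>\<Gamma> \<union> {\<phi>}. formula \<gamma>"
    and "\<Gamma> \<turnstile> \<phi>"
  shows "\<Gamma> \<Turnstile> \<phi>"
  unfolding entails_def by (intro allI impI) (rule derives_sound_partial[OF assms(2)])

end
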